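(* Let $R$ be a ring and let $D$ be a subring of $R$ which is a unique factorization domain. If there exists an irreducible element $p\in D$ such that $\frac{1}{p}\in R$ (i.e. $p$ is invertible in $R$), then $R$ is submaximal. In particular, if $U(R)\cap D\neq U(D)$, then $R$ is submaximal.
   Context: All rings are commutative with $1\neq 0$, and a subring of a ring contains the identity of that ring. A maximal subring of $R$ is a proper subring $S\subsetneq R$ such that there is no subring strictly between $S$ and $R$; $R$ is called submaximal if it has at least one maximal subring. $U(R)$ denotes the group of units of $R$. *)

theory Defs
  imports "HOL-Algebra.Subrings" "HOL-Algebra.Ring_Divisibility"
begin

definition maximal_subring :: "'a set \<Rightarrow> ('a, 'b) ring_scheme \<Rightarrow> bool" where
  "maximal_subring S R \<longleftrightarrow>
     subring S R \<and> S \<subset> carrier R \<and>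
     \<not> (\<exists>T. subring T R \<and> S \<subset> T \<and> T \<subset> carrier R)"

definition submaximal :: "('a, 'b) ring_scheme \<Rightarrow> bool" where
  "submaximal R \<longleftrightarrow> (\<exists>S. maximal_subring S R)"

end

theory Submission
  imports Defs
begin

text \<open>Write \<open>r = 1/p\<close>. By Zorn's lemma \<open>D\<close> may be replaced by a subring \<open>A\<close> that is maximal, for
  inclusions \<open>A \<subseteq> B\<close> with \<open>p B \<inter> A = p A\<close>, among the subrings in which \<open>p\<close> is a prime nonunit and no
  nonzero element is divisible by all powers of \<open>p\<close>. These properties pass to the polynomial ring
  \<open>A[y]\<close> for a transcendental \<open>y\<close> (Gauss), so every element of \<open>R\<close> is algebraic over \<open>A\<close>. Multiplying
  it by a power of \<open>p\<close> makes the leading coefficient \<open>u\<close> of an algebraic relation prime to \<open>p\<close>.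
  Let \<open>S \<supseteq> A\<close> be a maximal subring with \<open>p S \<inter> A = p A\<close>. A Nakayama argument shows that \<open>S\<close> contains
  all elements with such a relation, so \<open>R = S[1/p]\<close> while \<open>1/p \<notin> S\<close>. A subring that contains
  \<open>S\<close> and is maximal among those without \<open>1/p\<close> is then a maximal subring of \<open>R\<close>.\<close>

section \<open>The subring \<open>A[y]\<close> generated by one element, filtered by degree\<close>

context cring
begin

text \<open>For a subring \<open>A\<close> this is the \<open>A\<close>-module spanned by
  \<open>1, y, ..., y^(k-1)\<close>, the values at \<open>y\<close> of polynomials of degree less
  than \<open>k\<close>. The strict bound makes index \<open>0\<close> the zero module, which is
  where the later elimination of generators ends.\<close>

fun poly_vals :: "'a set \<Rightarrow> 'a \<Rightarrow> nat \<Rightarrow> 'a set" where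
  "poly_vals A y 0 = {\<zero>}"
| "poly_vals A y (Suc k) = {m \<oplus> s \<otimes> y [^] k | m s. m \<in> poly_vals A y k \<and> s \<in> A}"

definition adjoin :: "'a set \<Rightarrow> 'a \<Rightarrow> 'a set" where
  "adjoin A y = (\<Union>k. poly_vals A y k)"

lemma poly_vals_SucI:
  "\<lbrakk>m \<in> poly_vals A y k; s \<in> A\<rbrakk> \<Longrightarrow> m \<oplus> s \<otimes> y [^] k \<in> poly_vals A y (Suc k)"
  by auto

lemma poly_vals_mono_coeffs: "A \<subseteq> B \<Longrightarrow> poly_vals A y k \<subseteq> poly_vals B y k"
  by (induction k) (simp, fastforce)

context
  fixes A y
  assumes A: "subring A R" and y: "y \<in> carrier R"
begin

lemmas subring_simps =
  subringE(1)[OF A, THEN subsetD] subringE(2,3,5-7)[OF A] y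

lemma poly_vals_carrier: "m \<in> poly_vals A y k \<Longrightarrow> m \<in> carrier R"
  by (induction k arbitrary: m) (auto simp: subring_simps)

lemma poly_vals_zero: "\<zero> \<in> poly_vals A y k"
proof (induction k)
  case (Suc k)
  have "\<zero> = \<zero> \<oplus> \<zero> \<otimes> y [^] k" using y by simp
  then show ?case using poly_vals_SucI[OF Suc subringE(2)[OF A]] by metis
qed simp

lemma poly_vals_add:
  "\<lbrakk>m \<in> poly_vals A y k; n \<in> poly_vals A y k\<rbrakk> \<Longrightarrow> m \<oplus> n \<in> poly_vals A y k"
proof (induction k arbitrary: m n)
  case (Suc k)
  then obtain m' s n' t where *: "m = m' \<oplus> s \<otimes> y [^] k" "m' \<in> poly_vals A y k" "s \<in> A"
    "n = n' \<oplus> t \<otimes> y [^] k" "n' \<in> poly_vals A y k" "t \<in> A" by auto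
  have car: "m' \<in> carrier R" "n' \<in> carrier R" "s \<in> carrier R" "t \<in> carrier R" "y [^] k \<in> carrier R"
    using * by (auto simp: poly_vals_carrier subring_simps)
  have "m \<oplus> n = (m' \<oplus> n') \<oplus> (s \<oplus> t) \<otimes> y [^] k"
    unfolding * using car by algebra
  then show ?case using poly_vals_SucI[of "m' \<oplus> n'" A y k "s \<oplus> t"] Suc.IH * subring_simps by simp
qed simp

lemma poly_vals_smult: "\<lbrakk>m \<in> poly_vals A y k; a \<in> A\<rbrakk> \<Longrightarrow> a \<otimes> m \<in> poly_vals A y k"
proof (induction k arbitrary: m)
  case (Suc k)
  then obtain m' s where *: "m = m' \<oplus> s \<otimes> y [^] k" "m' \<in> poly_vals A y k" "s \<in> A" by auto
  have car: "m' \<in> carrier R" "a \<in> carrier R" "s \<in> carrier R" "y [^] k \<in> carrier R"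
    using * Suc.prems by (auto simp: poly_vals_carrier subring_simps)
  have "a \<otimes> m = a \<otimes> m' \<oplus> (a \<otimes> s) \<otimes> y [^] k"
    unfolding * using car by algebra
  then show ?case
    using poly_vals_SucI[of "a \<otimes> m'" A y k "a \<otimes> s"] Suc.IH Suc.prems * subring_simps by simp
qed (simp add: subring_simps)

lemma poly_vals_neg: "m \<in> poly_vals A y k \<Longrightarrow> \<ominus> m \<in> poly_vals A y k"
  using poly_vals_smult[of m k "\<ominus> \<one>"] poly_vals_carrier[of m k]
  by (simp add: subring_simps l_minus)

lemma poly_vals_Suc_mono: "m \<in> poly_vals A y k \<Longrightarrow> m \<in> poly_vals A y (Suc k)"
  using poly_vals_SucI[of m A y k \<zero>] poly_vals_carrier[of m k] subring_simps by simp

lemma poly_vals_mono: "\<lbrakk>m \<in> poly_vals A y j; j \<le> k\<rbrakk> \<Longrightarrow> m \<in> poly_vals A y k"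
  by (induction k) (auto simp del: poly_vals.simps(2) simp: le_Suc_eq intro: poly_vals_Suc_mono)

lemma poly_vals_shift: "m \<in> poly_vals A y k \<Longrightarrow> y \<otimes> m \<in> poly_vals A y (Suc k)"
proof (induction k arbitrary: m)
  case 0
  then show ?case using poly_vals_zero[of "Suc 0"] y by auto
next
  case (Suc k)
  then obtain m' s where *: "m = m' \<oplus> s \<otimes> y [^] k" "m' \<in> poly_vals A y k" "s \<in> A" by auto
  have car: "m' \<in> carrier R" "s \<in> carrier R" "y [^] k \<in> carrier R" "y \<in> carrier R"
    using * Suc.prems by (auto simp: poly_vals_carrier subring_simps)
  have "y \<otimes> m = y \<otimes> m' \<oplus> s \<otimes> (y [^] k \<otimes> y)"
    unfolding * using car by algebra
  then show ?case
    using poly_vals_SucI[of "y \<otimes> m'" A y "Suc k" s] Suc.IH * by simp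
qed

lemma poly_vals_shifts: "m \<in> poly_vals A y k \<Longrightarrow> y [^] i \<otimes> m \<in> poly_vals A y (i + k)"
proof (induction i)
  case 0
  then show ?case by (simp add: poly_vals_carrier)
next
  case (Suc i)
  have "y [^] Suc i \<otimes> m = y \<otimes> (y [^] i \<otimes> m)"
    using y poly_vals_carrier[OF Suc.prems] by (simp add: m_ac)
  then show ?case using poly_vals_shift Suc by simp
qed

lemma poly_vals_const: "a \<in> A \<Longrightarrow> a \<in> poly_vals A y (Suc 0)"
  using poly_vals_SucI[of \<zero> A y 0 a] by (simp add: subring_simps)

lemma poly_vals_mult:
  "\<lbrakk>m \<in> poly_vals A y j; n \<in> poly_vals A y k\<rbrakk> \<Longrightarrow> m \<otimes> n \<in> poly_vals A y (j + k)"
proof (induction j arbitrary: m)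
  case 0
  then show ?case by (simp add: poly_vals_carrier poly_vals_zero)
next
  case (Suc j)
  then obtain m' s where *: "m = m' \<oplus> s \<otimes> y [^] j" "m' \<in> poly_vals A y j" "s \<in> A" by auto
  have car: "m' \<in> carrier R" "s \<in> carrier R" "y [^] j \<in> carrier R" "n \<in> carrier R"
    using * Suc.prems by (auto simp: poly_vals_carrier subring_simps)
  have "m \<otimes> n = m' \<otimes> n \<oplus> s \<otimes> (y [^] j \<otimes> n)"
    unfolding * using car by algebra
  moreover have "m' \<otimes> n \<oplus> s \<otimes> (y [^] j \<otimes> n) \<in> poly_vals A y (j + k)"
    by (rule poly_vals_add[OF Suc.IH[OF *(2) Suc.prems(2)]
          poly_vals_smult[OF poly_vals_shifts[OF Suc.prems(2)] *(3)]])
  ultimately show ?case using poly_vals_Suc_mono by simp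
qed

text \<open>The definition peels off the leading term, whereas this form peels off the constant
  term. Divisibility by \<open>p\<close> in \<open>A[y]\<close> is later decided one constant term
  at a time.\<close>

lemma poly_vals_horner:
  "m \<in> poly_vals A y (Suc k) \<longleftrightarrow> (\<exists>a \<in> A. \<exists>m' \<in> poly_vals A y k. m = a \<oplus> y \<otimes> m')"
proof
  assume "\<exists>a \<in> A. \<exists>m' \<in> poly_vals A y k. m = a \<oplus> y \<otimes> m'"
  then show "m \<in> poly_vals A y (Suc k)"
    using poly_vals_add[OF poly_vals_mono[OF poly_vals_const] poly_vals_shift]
    by (metis Suc_le_mono zero_le)
next
  show "m \<in> poly_vals A y (Suc k) \<Longrightarrow> \<exists>a \<in> A. \<exists>m' \<in> poly_vals A y k. m = a \<oplus> y \<otimes> m'"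
  proof (induction k arbitrary: m)
    case 0
    then show ?case using y by (auto simp: subring_simps)
  next
    case (Suc k)
    then obtain n s where *: "m = n \<oplus> s \<otimes> y [^] Suc k" "n \<in> poly_vals A y (Suc k)" "s \<in> A"
      by auto
    from Suc.IH[OF *(2)] obtain a n' where n: "a \<in> A" "n' \<in> poly_vals A y k" "n = a \<oplus> y \<otimes> n'"
      by blast
    have car: "n' \<in> carrier R" "a \<in> carrier R" "s \<in> carrier R" "y [^] k \<in> carrier R" "y \<in> carrier R"
      using * n by (auto simp: poly_vals_carrier subring_simps)
    have "m = a \<oplus> y \<otimes> (n' \<oplus> s \<otimes> y [^] k)"
      unfolding * n nat_pow_Suc using car by algebra
    then show ?case using n(1) poly_vals_SucI[OF n(2) *(3)] by blast
  qed
qed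

lemma adjoinI: "m \<in> poly_vals A y k \<Longrightarrow> m \<in> adjoin A y"
  by (auto simp: adjoin_def)

lemma subring_adjoin: "subring (adjoin A y) R"
proof (rule subringI)
  show "adjoin A y \<subseteq> carrier R" by (auto simp: adjoin_def poly_vals_carrier)
  show "\<one> \<in> adjoin A y" using adjoinI[OF poly_vals_const] subring_simps by blast
  show "\<ominus> h \<in> adjoin A y" if "h \<in> adjoin A y" for h
    using that by (auto simp: adjoin_def intro: poly_vals_neg)
  show "g \<otimes> h \<in> adjoin A y" if "g \<in> adjoin A y" "h \<in> adjoin A y" for g h
    using that by (auto simp: adjoin_def intro: poly_vals_mult)
  show "g \<oplus> h \<in> adjoin A y" if "g \<in> adjoin A y" "h \<in> adjoin A y" for g h
  proof -
    from that obtain j k where "g \<in> poly_vals A y j" "h \<in> poly_vals A y k"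
      by (auto simp: adjoin_def)
    then have "g \<oplus> h \<in> poly_vals A y (max j k)"
      by (intro poly_vals_add) (auto intro: poly_vals_mono)
    then show ?thesis by (rule adjoinI)
  qed
qed

lemma subset_adjoin: "A \<subseteq> adjoin A y"
  using adjoinI[OF poly_vals_const] by blast

lemma mem_adjoin: "y \<in> adjoin A y"
  using adjoinI[OF poly_vals_shift[OF poly_vals_const[OF subringE(3)[OF A]]]] y by simp

lemma adjoin_horner: "m \<in> adjoin A y \<longleftrightarrow> (\<exists>a \<in> A. \<exists>m' \<in> adjoin A y. m = a \<oplus> y \<otimes> m')"
proof
  assume "m \<in> adjoin A y"
  then obtain k where "m \<in> poly_vals A y (Suc k)"
    by (auto simp: adjoin_def dest: poly_vals_Suc_mono)
  then show "\<exists>a \<in> A. \<exists>m' \<in> adjoin A y. m = a \<oplus> y \<otimes> m'"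
    unfolding poly_vals_horner using adjoinI by blast
next
  assume "\<exists>a \<in> A. \<exists>m' \<in> adjoin A y. m = a \<oplus> y \<otimes> m'"
  then show "m \<in> adjoin A y"
    using subset_adjoin mem_adjoin subringE(6,7)[OF subring_adjoin] by blast
qed

text \<open>Zero leading coefficients of \<open>q\<close> are dropped until a nonzero one appears,
  and the relation is solved for that top term. If none appears, then \<open>q\<close> is zero and
  hence so is \<open>a\<close>, against the last hypothesis.\<close>

lemma algebraic_relation:
  assumes "a \<in> A" "q \<in> poly_vals A y n" "a \<oplus> y \<otimes> q = \<zero>" "a \<noteq> \<zero> \<or> q \<noteq> \<zero>"
  shows "\<exists>k. \<exists>c \<in> A. c \<noteq> \<zero> \<and> c \<otimes> y [^] k \<in> poly_vals A y k"
  using assms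
proof (induction n arbitrary: q)
  case 0
  then show ?case using y by (auto simp: subring_simps)
next
  case (Suc n)
  then obtain m s where *: "q = m \<oplus> s \<otimes> y [^] n" "m \<in> poly_vals A y n" "s \<in> A" by auto
  have car: "m \<in> carrier R" "a \<in> carrier R" "s \<in> carrier R" "y [^] n \<in> carrier R" "y \<in> carrier R"
    using * Suc.prems by (auto simp: poly_vals_carrier subring_simps)
  show ?case
  proof (cases "s = \<zero>")
    case True
    then have "q = m" using * car by simp
    then show ?thesis using Suc * by blast
  next
    case False
    \<comment> \<open>Only the top term of \<open>y q\<close> survives the subtraction, and
      \<open>a + y q\<close> vanishes.\<close>
    have "s \<otimes> y [^] Suc n = (a \<oplus> y \<otimes> q) \<ominus> (a \<oplus> y \<otimes> m)"
      unfolding * nat_pow_Suc using car by algebra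
    also have "\<dots> = \<ominus> (a \<oplus> y \<otimes> m)"
      using Suc.prems(3) car by (simp add: minus_eq)
    also have "\<dots> \<in> poly_vals A y (Suc n)"
      using poly_vals_horner poly_vals_neg Suc.prems(1) *(2) by blast
    finally show ?thesis using False *(3) by blast
  qed
qed

end

text \<open>A term \<open>s y^i\<close> with \<open>i \<le> k\<close> becomes
  \<open>(s q^(k-i)) (q y)^i\<close>, which has its coefficient in \<open>A\<close> again.\<close>

lemma poly_vals_rescale:
  assumes A: "subring A R" and y: "y \<in> carrier R" and q: "q \<in> A"
  shows "m \<in> poly_vals A y (Suc k) \<Longrightarrow> q [^] k \<otimes> m \<in> poly_vals A (q \<otimes> y) (Suc k)"
proof (induction k arbitrary: m)
  case 0
  then obtain s where "m = \<zero> \<oplus> s \<otimes> \<one>" "s \<in> A" by auto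
  moreover then have "m = s" using subringE(1)[OF A] by (auto simp: subset_eq)
  ultimately show ?case
    using subringE(1)[OF A] poly_vals_const[OF A] q y by (auto simp: subset_eq simp del: poly_vals.simps(2))
next
  case (Suc k)
  then obtain n s where *: "m = n \<oplus> s \<otimes> y [^] Suc k" "n \<in> poly_vals A y (Suc k)" "s \<in> A"
    by auto
  have car: "n \<in> carrier R" "q \<in> carrier R" "s \<in> carrier R" "q [^] k \<in> carrier R" "y [^] Suc k \<in> carrier R"
      "q [^] Suc k \<in> carrier R" "q \<otimes> y \<in> carrier R"
    using * q y subringE(1)[OF A] poly_vals_carrier[OF A y, of n "Suc k"] by auto
  have "q [^] Suc k \<otimes> m = q [^] Suc k \<otimes> n \<oplus> s \<otimes> (q [^] Suc k \<otimes> y [^] Suc k)"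
    unfolding * using car by algebra
  also have "q [^] Suc k \<otimes> y [^] Suc k = (q \<otimes> y) [^] Suc k"
    using nat_pow_distrib[OF car(2) y] by metis
  also have "q [^] Suc k \<otimes> n = q \<otimes> (q [^] k \<otimes> n)"
    using car by (simp add: m_ac)
  finally show ?case
    using poly_vals_SucI[OF poly_vals_smult[OF A car(7) Suc.IH[OF *(2)] q] *(3)] by simp
qed

section \<open>Zorn's lemma for subrings\<close>

lemma subring_Union_chain:
  assumes "C \<noteq> {}" "\<And>A. A \<in> C \<Longrightarrow> subring A R"
    and "\<And>A B. \<lbrakk>A \<in> C; B \<in> C\<rbrakk> \<Longrightarrow> A \<subseteq> B \<or> B \<subseteq> A"
  shows "subring (\<Union>C) R"
proof (rule subringI)
  have common: "\<exists>A \<in> C. g \<in> A \<and> h \<in> A" if "g \<in> \<Union>C" "h \<in> \<Union>C" for g h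
    using that assms(3) by blast
  show "\<Union>C \<subseteq> carrier R" using subringE(1)[OF assms(2)] by blast
  show "\<one> \<in> \<Union>C" using subringE(3)[OF assms(2)] assms(1) by blast
  show "\<ominus> h \<in> \<Union>C" if "h \<in> \<Union>C" for h using subringE(5)[OF assms(2)] that by blast
  show "g \<otimes> h \<in> \<Union>C" "g \<oplus> h \<in> \<Union>C" if "g \<in> \<Union>C" "h \<in> \<Union>C" for g h
    using common[OF that] subringE(6,7)[OF assms(2)] by blast+
qed

text \<open>This serves twice: with \<open>W\<close> the set of quotients by \<open>p\<close> that
  would violate purity, and with \<open>W\<close> consisting of \<open>1/p\<close> alone.\<close>

lemma maximal_avoiding_subring:
  assumes "subring A R" "A \<inter> W = {}"
  obtains S where "subring S R" "A \<subseteq> S" "S \<inter> W = {}"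
    "\<And>T. \<lbrakk>subring T R; S \<subseteq> T; T \<inter> W = {}\<rbrakk> \<Longrightarrow> T = S"
proof -
  let ?F = "{S. subring S R \<and> A \<subseteq> S \<and> S \<inter> W = {}}"
  have "\<exists>M \<in> ?F. \<forall>X \<in> ?F. M \<subseteq> X \<longrightarrow> X = M"
  proof (rule subset_Zorn_nonempty)
    fix C assume "C \<noteq> {}" "subset.chain ?F C"
    then show "\<Union>C \<in> ?F"
      using subring_Union_chain[of C] unfolding subset.chain_def by blast
  qed (use assms in blast)
  then show thesis using that by (smt (verit) mem_Collect_eq subset_trans)
qed

end

section \<open>An invertible element \<open>p\<close> and divisibility by it in subrings\<close>

locale cring_inverse = cring R for R (structure) +
  fixes p r
  assumes p_closed [simp]: "p \<in> carrier R" and r_closed [simp]: "r \<in> carrier R"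
    and p_r: "p \<otimes> r = \<one>"
begin

lemma r_p: "r \<otimes> p = \<one>"
  using p_r by (simp add: m_comm)

lemma mult_r_eq_iff:
  assumes "a \<in> carrier R" "b \<in> carrier R"
  shows "a \<otimes> r = b \<longleftrightarrow> a = p \<otimes> b"
proof
  assume "a \<otimes> r = b"
  then have "p \<otimes> b = a \<otimes> (p \<otimes> r)" using assms by (auto simp: m_ac)
  then show "a = p \<otimes> b" using assms p_r by simp
next
  assume "a = p \<otimes> b"
  then have "a \<otimes> r = b \<otimes> (p \<otimes> r)" using assms by (simp add: m_ac)
  then show "a \<otimes> r = b" using assms p_r by simp
qed

lemma p_mult_mult_r [simp]: "a \<in> carrier R \<Longrightarrow> p \<otimes> (a \<otimes> r) = a"
  using mult_r_eq_iff[of a "a \<otimes> r"] by simp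

lemma p_r_pow: "p [^] (n::nat) \<otimes> r [^] n = \<one>"
  using nat_pow_distrib[of p r n] p_r by simp

lemma mult_r_pow_eq_iff:
  assumes "a \<in> carrier R" "b \<in> carrier R"
  shows "a \<otimes> r [^] (n::nat) = b \<longleftrightarrow> a = p [^] n \<otimes> b"
proof
  assume "a \<otimes> r [^] n = b"
  then have "p [^] n \<otimes> b = a \<otimes> (p [^] n \<otimes> r [^] n)" using assms by (auto simp: m_ac)
  then show "a = p [^] n \<otimes> b" using assms p_r_pow by simp
next
  assume "a = p [^] n \<otimes> b"
  then have "a \<otimes> r [^] n = b \<otimes> (p [^] n \<otimes> r [^] n)" using assms by (simp add: m_ac)
  then show "a \<otimes> r [^] n = b" using assms p_r_pow by simp
qed

text \<open>Divisibility of \<open>x\<close> by \<open>p\<close> in a subring \<open>A\<close> is expressed as \<open>x \<otimes> r \<in> A\<close>.\<close>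

definition separated_prime :: "'a set \<Rightarrow> bool" where
  "separated_prime A \<longleftrightarrow> subring A R \<and> p \<in> A \<and> r \<notin> A \<and>
     (\<forall>x \<in> A. \<forall>y \<in> A. x \<otimes> y \<otimes> r \<in> A \<longrightarrow> x \<otimes> r \<in> A \<or> y \<otimes> r \<in> A) \<and>
     (\<forall>x \<in> A. x \<noteq> \<zero> \<longrightarrow> (\<exists>n::nat. x \<otimes> r [^] n \<notin> A))"

text \<open>As \<open>x \<otimes> r \<in> B\<close> says that \<open>x\<close> lies in
  \<open>p B\<close>, the second condition amounts to \<open>p B \<inter> A = p A\<close> when
  \<open>p \<in> A\<close> and both are subrings. Nondivisibility by \<open>p\<close> in
  \<open>A\<close> thus persists in \<open>B\<close>.\<close>

definition pure :: "'a set \<Rightarrow> 'a set \<Rightarrow> bool" where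
  "pure A B \<longleftrightarrow> A \<subseteq> B \<and> (\<forall>x \<in> A. x \<otimes> r \<in> B \<longrightarrow> x \<otimes> r \<in> A)"

lemma separated_primeD:
  assumes "separated_prime A"
  shows "subring A R" "p \<in> A" "r \<notin> A"
    and "\<And>x y. \<lbrakk>x \<in> A; y \<in> A; x \<otimes> y \<otimes> r \<in> A\<rbrakk> \<Longrightarrow> x \<otimes> r \<in> A \<or> y \<otimes> r \<in> A"
    and "\<And>x. \<lbrakk>x \<in> A; x \<noteq> \<zero>\<rbrakk> \<Longrightarrow> \<exists>n::nat. x \<otimes> r [^] n \<notin> A"
  using assms unfolding separated_prime_def by blast+

lemma pure_refl: "pure A A"
  by (simp add: pure_def)

text \<open>If \<open>x r^(n+1)\<close> is in \<open>B\<close>, then multiplying by \<open>p\<close>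
  puts \<open>x r^n\<close> in \<open>B\<close>, hence in \<open>A\<close> by induction. Purity then
  applies to \<open>x r^n\<close>.\<close>

lemma pure_pow:
  assumes "pure A B" "subring B R" "p \<in> B" "x \<in> A"
  shows "x \<otimes> r [^] (n::nat) \<in> B \<Longrightarrow> x \<otimes> r [^] n \<in> A"
proof (induction n)
  case 0
  then show ?case using assms subringE(1)[OF assms(2)] by (auto simp: pure_def subset_eq)
next
  case (Suc n)
  have x: "x \<in> carrier R" using assms subringE(1)[OF assms(2)] by (auto simp: pure_def)
  have *: "x \<otimes> r [^] Suc n = (x \<otimes> r [^] n) \<otimes> r" using x by (simp add: m_assoc)
  have "p \<otimes> ((x \<otimes> r [^] n) \<otimes> r) \<in> B"
    using Suc.prems assms subringE(6)[OF assms(2)] * by simp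
  then have "x \<otimes> r [^] n \<in> A" using Suc.IH x by simp
  then show ?case using Suc.prems assms(1) * by (auto simp: pure_def)
qed

text \<open>Every member of the chain is pure in the union, so a divisibility in the union between
  elements of one member already holds in that member. Primality and separation can be tested
  there.\<close>

lemma separated_prime_Union:
  assumes "C \<noteq> {}" and sp: "\<And>A. A \<in> C \<Longrightarrow> separated_prime A"
    and chain: "\<And>A B. \<lbrakk>A \<in> C; B \<in> C\<rbrakk> \<Longrightarrow> pure A B \<or> pure B A"
  shows "separated_prime (\<Union>C)" and "\<And>A. A \<in> C \<Longrightarrow> pure A (\<Union>C)"
proof -
  have sub: "A \<subseteq> B \<or> B \<subseteq> A" if "A \<in> C" "B \<in> C" for A B
    using chain[OF that] by (auto simp: pure_def)
  have ring: "subring (\<Union>C) R"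
    using subring_Union_chain[OF assms(1) separated_primeD(1)[OF sp] sub] .
  show pure: "pure A (\<Union>C)" if A: "A \<in> C" for A
    unfolding pure_def
  proof (intro conjI ballI impI)
    show "A \<subseteq> \<Union>C" using A by blast
  next
    fix x assume x: "x \<in> A" "x \<otimes> r \<in> \<Union>C"
    then obtain B where "B \<in> C" "x \<otimes> r \<in> B" by blast
    then show "x \<otimes> r \<in> A" using chain[OF A] x by (auto simp: pure_def)
  qed
  have p: "p \<in> \<Union>C" using assms(1) separated_primeD(2)[OF sp] by blast
  show "separated_prime (\<Union>C)"
    unfolding separated_prime_def
  proof (intro conjI ballI impI ring p)
    show "r \<notin> \<Union>C" using separated_primeD(3)[OF sp] by blast
  next
    fix x y assume xy: "x \<in> \<Union>C" "y \<in> \<Union>C" "x \<otimes> y \<otimes> r \<in> \<Union>C"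
    then obtain A where A: "A \<in> C" "x \<in> A" "y \<in> A" using sub by blast
    then have "x \<otimes> y \<in> A" using subringE(6)[OF separated_primeD(1)[OF sp]] by blast
    then have "x \<otimes> y \<otimes> r \<in> A" using pure[OF A(1)] xy(3) by (auto simp: pure_def)
    then show "x \<otimes> r \<in> \<Union>C \<or> y \<otimes> r \<in> \<Union>C"
      using separated_primeD(4)[OF sp] A by blast
  next
    fix x assume x: "x \<in> \<Union>C" "x \<noteq> \<zero>"
    then obtain A where A: "A \<in> C" "x \<in> A" by blast
    then obtain n :: nat where "x \<otimes> r [^] n \<notin> A" using separated_primeD(5)[OF sp] x by blast
    then show "\<exists>n::nat. x \<otimes> r [^] n \<notin> \<Union>C"
      using pure_pow[OF pure[OF A(1)] ring p A(2)] by blast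
  qed
qed

lemma maximal_separated_prime:
  assumes "separated_prime D"
  obtains A where "separated_prime A" "\<And>B. \<lbrakk>separated_prime B; pure A B\<rbrakk> \<Longrightarrow> B = A"
proof -
  let ?F = "{A. separated_prime A}"
  have "\<exists>A \<in> ?F. \<forall>B \<in> ?F. pure A B \<longrightarrow> B = A"
  proof (rule predicate_Zorn)
    show "partial_order_on ?F (relation_of pure ?F)"
      by (rule partial_order_on_relation_ofI) (fastforce simp: pure_def)+
  next
    fix C assume C: "C \<in> Chains (relation_of pure ?F)"
    then have sp: "separated_prime A" if "A \<in> C" for A
      using Chains_relation_of that by blast
    have chain: "pure A B \<or> pure B A" if "A \<in> C" "B \<in> C" for A B
      using C that by (auto simp: Chains_def relation_of_def)
    show "\<exists>U \<in> ?F. \<forall>A \<in> C. pure A U"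
    proof (cases "C = {}")
      case False
      then show ?thesis using separated_prime_Union[OF False sp chain] by blast
    \<comment> \<open>The empty chain has \<open>D\<close> as an upper bound.\<close>
    qed (use assms in blast)
  qed
  then show thesis using that by blast
qed

section \<open>Extension by a transcendental element\<close>

context
  fixes A y
  assumes A: "separated_prime A" and y: "y \<in> carrier R"
    and transcendental: "\<And>a q. \<lbrakk>a \<in> A; q \<in> adjoin A y; a \<oplus> y \<otimes> q = \<zero>\<rbrakk> \<Longrightarrow> a = \<zero> \<and> q = \<zero>"
begin

lemmas A_ring = separated_primeD(1)[OF A]
lemmas B_ring = subring_adjoin[OF A_ring y]
lemmas A_carrier = subringE(1)[OF A_ring, THEN subsetD]
lemmas B_carrier = subringE(1)[OF B_ring, THEN subsetD]
lemmas B_closed = subringE(6,7)[OF B_ring]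

lemma p_adjoin: "p \<in> adjoin A y"
  using subset_adjoin[OF A_ring y] separated_primeD(2)[OF A] by blast

text \<open>The transcendence hypothesis is applied to the difference of the two
  expressions.\<close>

lemma horner_unique:
  assumes "a \<in> A" "b \<in> A" "m \<in> adjoin A y" "n \<in> adjoin A y" "a \<oplus> y \<otimes> m = b \<oplus> y \<otimes> n"
  shows "a = b" "m = n"
proof -
  have car: "a \<in> carrier R" "b \<in> carrier R" "m \<in> carrier R" "n \<in> carrier R"
    using assms A_carrier B_carrier by auto
  have "(a \<ominus> b) \<oplus> y \<otimes> (m \<ominus> n) = (a \<oplus> y \<otimes> m) \<ominus> (b \<oplus> y \<otimes> n)"
    using car y by algebra
  also have "\<dots> = \<zero>" using assms(5) car y by simp
  finally have "a \<ominus> b = \<zero> \<and> m \<ominus> n = \<zero>"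
    using assms subringE(5,7)[OF A_ring] subringE(5,7)[OF B_ring]
    by (intro transcendental) (simp_all add: minus_eq)
  then show "a = b" "m = n" using car by simp_all
qed

text \<open>Write the quotient by \<open>p^n\<close> as \<open>c + y h\<close>, multiply back by
  \<open>p^n\<close>, and compare constant terms and cofactors by uniqueness.\<close>

lemma horner_mult_r_pow:
  assumes "a \<in> A" "m \<in> adjoin A y" "(a \<oplus> y \<otimes> m) \<otimes> r [^] (n::nat) \<in> adjoin A y"
  shows "a \<otimes> r [^] n \<in> A" "m \<otimes> r [^] n \<in> adjoin A y"
proof -
  have car: "a \<in> carrier R" "m \<in> carrier R" using assms A_carrier B_carrier by auto
  from assms(3) obtain c h where *: "c \<in> A" "h \<in> adjoin A y"
    "(a \<oplus> y \<otimes> m) \<otimes> r [^] n = c \<oplus> y \<otimes> h"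
    using adjoin_horner[OF A_ring y] by blast
  have car': "c \<in> carrier R" "h \<in> carrier R" using * A_carrier B_carrier by auto
  have pn: "p [^] n \<in> A"
    using separated_primeD(2)[OF A] subringE(3,6)[OF A_ring] by (induction n) auto
  have "a \<oplus> y \<otimes> m = p [^] n \<otimes> (c \<oplus> y \<otimes> h)"
    using *(3) mult_r_pow_eq_iff[of "a \<oplus> y \<otimes> m" "c \<oplus> y \<otimes> h" n] car car' y by simp
  also have "\<dots> = p [^] n \<otimes> c \<oplus> y \<otimes> (p [^] n \<otimes> h)"
  proof -
    have "p [^] n \<in> carrier R" by simp
    then show ?thesis using car' y by algebra
  qed
  finally have "a = p [^] n \<otimes> c" "m = p [^] n \<otimes> h"
    using horner_unique assms * pn subringE(6)[OF A_ring] B_closed(1) subset_adjoin[OF A_ring y]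
    by (metis subsetD)+
  then have "a \<otimes> r [^] n = c" "m \<otimes> r [^] n = h"
    using mult_r_pow_eq_iff car car' by blast+
  then show "a \<otimes> r [^] n \<in> A" "m \<otimes> r [^] n \<in> adjoin A y" using * by simp_all
qed

lemma horner_mult_r:
  assumes "a \<in> A" "m \<in> adjoin A y" "(a \<oplus> y \<otimes> m) \<otimes> r \<in> adjoin A y"
  shows "a \<otimes> r \<in> A" "m \<otimes> r \<in> adjoin A y"
  using horner_mult_r_pow[of a m 1] assms by simp_all

lemma pure_adjoin: "pure A (adjoin A y)"
  unfolding pure_def
proof (intro conjI ballI impI)
  show "A \<subseteq> adjoin A y" by (rule subset_adjoin[OF A_ring y])
next
  fix x assume "x \<in> A" "x \<otimes> r \<in> adjoin A y"
  then show "x \<otimes> r \<in> A"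
    using horner_mult_r(1)[of x \<zero>] subringE(2)[OF B_ring] A_carrier y by simp
qed

text \<open>Since \<open>p\<close> divides \<open>a\<close>, subtracting \<open>a g\<close> keeps
  the product divisible by \<open>p\<close>. What remains is \<open>y f g\<close>, with constant
  term \<open>0\<close>, so its cofactor \<open>f g\<close> is divisible.\<close>

lemma adjoin_prime_step:
  assumes a: "a \<in> A" "a \<otimes> r \<in> A" and f: "f \<in> adjoin A y" and g: "g \<in> adjoin A y"
    and fg: "(a \<oplus> y \<otimes> f) \<otimes> g \<otimes> r \<in> adjoin A y"
  shows "f \<otimes> g \<otimes> r \<in> adjoin A y"
proof -
  have car: "a \<in> carrier R" "f \<in> carrier R" "g \<in> carrier R" using a f g A_carrier B_carrier by auto
  have "(\<zero> \<oplus> y \<otimes> (f \<otimes> g)) \<otimes> r = (a \<oplus> y \<otimes> f) \<otimes> g \<otimes> r \<oplus> \<ominus> ((a \<otimes> r) \<otimes> g)"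
    using car y r_closed by algebra
  also have "\<dots> \<in> adjoin A y"
    using fg g a(2) subset_adjoin[OF A_ring y] B_closed subringE(5)[OF B_ring] by (simp add: subset_eq)
  finally show ?thesis
    using horner_mult_r(2)[of \<zero> "f \<otimes> g"] f g B_closed subringE(2)[OF A_ring] by simp
qed

text \<open>Gauss's lemma: \<open>p\<close> divides one of the two constant coefficients, and then that constant
  coefficient can be dropped.\<close>

lemma adjoin_prime:
  "\<lbrakk>f \<in> poly_vals A y i; g \<in> poly_vals A y j; f \<otimes> g \<otimes> r \<in> adjoin A y\<rbrakk>
    \<Longrightarrow> f \<otimes> r \<in> adjoin A y \<or> g \<otimes> r \<in> adjoin A y"
\<comment> \<open>Either factor may be the one that gets shorter, so the induction runs on the sum
  of the two degree bounds.\<close>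
proof (induction "i + j" arbitrary: i j f g rule: less_induct)
  case less
  show ?case
  proof (cases "i = 0 \<or> j = 0")
    case True
    then show ?thesis using less.prems subringE(2)[OF B_ring] by auto
  next
    case False
    then obtain i' j' where ij: "i = Suc i'" "j = Suc j'" by (meson not0_implies_Suc)
    obtain a f' b g' where *: "a \<in> A" "f' \<in> poly_vals A y i'" "f = a \<oplus> y \<otimes> f'"
      "b \<in> A" "g' \<in> poly_vals A y j'" "g = b \<oplus> y \<otimes> g'"
      using less.prems ij poly_vals_horner[OF A_ring y] by metis
    have B: "f' \<in> adjoin A y" "g' \<in> adjoin A y" "f \<in> adjoin A y" "g \<in> adjoin A y"
      "a \<in> adjoin A y"
      using * less.prems adjoinI[OF A_ring y] subset_adjoin[OF A_ring y] by blast+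
    have car: "a \<in> carrier R" "b \<in> carrier R" "f' \<in> carrier R" "g' \<in> carrier R"
      "f \<in> carrier R" "g \<in> carrier R"
      using * B A_carrier B_carrier by auto
    \<comment> \<open>The constant term of \<open>f g\<close> is \<open>a b\<close>, so primality of
      \<open>p\<close> in \<open>A\<close> can be applied to it.\<close>
    have "f \<otimes> g = a \<otimes> b \<oplus> y \<otimes> (a \<otimes> g' \<oplus> f' \<otimes> g)"
      unfolding * using car y by algebra
    then have "a \<otimes> b \<otimes> r \<in> A"
      using horner_mult_r(1)[of "a \<otimes> b" "a \<otimes> g' \<oplus> f' \<otimes> g"] less.prems(3) * B B_closed
        subringE(6)[OF A_ring] by simp
    then consider "a \<otimes> r \<in> A" | "b \<otimes> r \<in> A"
      using separated_primeD(4)[OF A] * by blast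
    then show ?thesis
    proof cases
      case 1
      have "f' \<otimes> g \<otimes> r \<in> adjoin A y"
        using adjoin_prime_step[OF *(1) 1 B(1) B(4)] less.prems(3) *(3) by simp
      then have "f' \<otimes> r \<in> adjoin A y \<or> g \<otimes> r \<in> adjoin A y"
        using less.hyps[of i' j f' g] ij * less.prems by simp
      \<comment> \<open>Divisibility of \<open>f'\<close> returns to \<open>f\<close>, because
        \<open>a\<close> is divisible as well.\<close>
      moreover have "f \<otimes> r = a \<otimes> r \<oplus> y \<otimes> (f' \<otimes> r)"
        unfolding * using car y r_closed by algebra
      ultimately show ?thesis using adjoin_horner[OF A_ring y] 1 by metis
    next
      case 2
      have "g' \<otimes> f \<otimes> r \<in> adjoin A y"
        using adjoin_prime_step[OF *(4) 2 B(2) B(3)] less.prems(3) *(6) car m_comm[of f g] by simp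
      then have "f \<otimes> r \<in> adjoin A y \<or> g' \<otimes> r \<in> adjoin A y"
        using less.hyps[of i j' f g'] ij * less.prems car m_comm[of f g'] by simp
      moreover have "g \<otimes> r = b \<otimes> r \<oplus> y \<otimes> (g' \<otimes> r)"
        unfolding * using car y r_closed by algebra
      ultimately show ?thesis using adjoin_horner[OF A_ring y] 2 by metis
    qed
  qed
qed

text \<open>If all powers of \<open>p\<close> divided \<open>f\<close>, they would divide its
  constant term and its cofactor, at least one of which is nonzero.\<close>

lemma adjoin_separated:
  "\<lbrakk>f \<in> poly_vals A y k; f \<noteq> \<zero>\<rbrakk> \<Longrightarrow> \<exists>n::nat. f \<otimes> r [^] n \<notin> adjoin A y"
proof (induction k arbitrary: f)
  case (Suc k)
  then obtain a f' where *: "a \<in> A" "f' \<in> poly_vals A y k" "f = a \<oplus> y \<otimes> f'"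
    using poly_vals_horner[OF A_ring y] by metis
  then have f': "f' \<in> adjoin A y" using adjoinI[OF A_ring y] by blast
  have "a \<noteq> \<zero> \<or> f' \<noteq> \<zero>" using * Suc.prems y by auto
  then show ?case
    using separated_primeD(5)[OF A *(1)] Suc.IH[OF *(2)] horner_mult_r_pow[OF *(1) f'] *(3) by blast
qed simp

lemma separated_prime_adjoin: "separated_prime (adjoin A y)"
  unfolding separated_prime_def
proof (intro conjI ballI impI B_ring p_adjoin)
  \<comment> \<open>Purity is applied to the element \<open>1\<close> of \<open>A\<close>.\<close>
  show "r \<notin> adjoin A y"
    using pure_adjoin subringE(3)[OF A_ring] separated_primeD(3)[OF A]
    by (metis l_one pure_def r_closed)
next
  fix f g assume "f \<in> adjoin A y" "g \<in> adjoin A y" "f \<otimes> g \<otimes> r \<in> adjoin A y"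
  then show "f \<otimes> r \<in> adjoin A y \<or> g \<otimes> r \<in> adjoin A y"
    using adjoin_prime by (metis UN_E adjoin_def)
next
  fix f assume "f \<in> adjoin A y" "f \<noteq> \<zero>"
  then show "\<exists>n::nat. f \<otimes> r [^] n \<notin> adjoin A y"
    using adjoin_separated by (metis UN_E adjoin_def)
qed

end

section \<open>Algebraic relations over a maximal separated prime subring\<close>

lemma maximal_imp_algebraic:
  assumes A: "separated_prime A" and max: "\<And>B. \<lbrakk>separated_prime B; pure A B\<rbrakk> \<Longrightarrow> B = A"
    and y: "y \<in> carrier R"
  shows "\<exists>k. \<exists>c \<in> A. c \<noteq> \<zero> \<and> c \<otimes> y [^] k \<in> poly_vals A y k"
proof (rule ccontr)
  note ring = separated_primeD(1)[OF A]
  assume neg: "\<not> ?thesis"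
  have tr: "a = \<zero> \<and> q = \<zero>" if q: "a \<in> A" "q \<in> adjoin A y" "a \<oplus> y \<otimes> q = \<zero>" for a q
  proof -
    obtain n where "q \<in> poly_vals A y n" using q(2) by (auto simp: adjoin_def)
    then show ?thesis using algebraic_relation[OF ring y q(1) _ q(3)] neg by blast
  qed
  have "adjoin A y = A"
    using max separated_prime_adjoin[OF A y tr] pure_adjoin[OF A y tr] by blast
  then have "y \<in> A" using mem_adjoin[OF ring y] by simp
  \<comment> \<open>An element of \<open>A\<close> satisfies the relation with \<open>a = -y\<close>
    and \<open>q = 1\<close>. Transcendence would then make the ring trivial and put
    \<open>r = 0\<close> into \<open>A\<close>.\<close>
  then have "\<ominus> y \<in> A" "\<one> \<in> adjoin A y" "\<ominus> y \<oplus> y \<otimes> \<one> = \<zero>"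
    using subringE(3)[OF subring_adjoin[OF ring y]] subringE(5)[OF ring] y by (auto simp: l_neg)
  then have "\<one> = \<zero>" using tr by blast
  then have "r = \<zero>" using r_closed r_one r_null by metis
  then show False using subringE(2)[OF ring] separated_primeD(3)[OF A] by simp
qed

text \<open>Write \<open>c = p^e u\<close> with \<open>e\<close> as large as possible, which
  separation allows. Multiplying the relation by \<open>p^(e(k-1))\<close> turns its left side into
  \<open>u (p^e y)^k\<close>.\<close>

lemma algebraic_rescale:
  assumes A: "separated_prime A" and y: "y \<in> carrier R"
    and c: "c \<in> A" "c \<noteq> \<zero>" "c \<otimes> y [^] k \<in> poly_vals A y k"
  obtains e u where "u \<in> A" "u \<otimes> r \<notin> A"
    "u \<otimes> (p [^] (e::nat) \<otimes> y) [^] k \<in> poly_vals A (p [^] e \<otimes> y) k"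
proof -
  note ring = separated_primeD(1)[OF A]
  have car: "c \<in> carrier R" using c subringE(1)[OF ring] by blast
  define n where "n = (LEAST n::nat. c \<otimes> r [^] n \<notin> A)"
  have n: "c \<otimes> r [^] n \<notin> A"
    unfolding n_def using separated_primeD(5)[OF A c(1,2)] by (rule LeastI_ex)
  \<comment> \<open>The least failing exponent is positive because \<open>c\<close> itself lies in
    \<open>A\<close>, so its predecessor is the exact power of \<open>p\<close> in
    \<open>c\<close>.\<close>
  then obtain e where e: "n = Suc e" using c(1) car by (cases n) auto
  have u: "c \<otimes> r [^] e \<in> A"
    using not_less_Least[of e "\<lambda>n. c \<otimes> r [^] n \<notin> A"] e n_def by auto
  let ?u = "c \<otimes> r [^] e" and ?q = "p [^] e"
  have ur: "?u \<otimes> r \<notin> A" using n e car by (simp add: m_assoc)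
  have cu: "c = ?q \<otimes> ?u" using mult_r_pow_eq_iff[of c ?u e] car by simp
  \<comment> \<open>For \<open>k = 0\<close> the relation would force \<open>c = 0\<close>.\<close>
  obtain l where l: "k = Suc l" using c car by (cases k) auto
  have q: "?q \<in> A"
    using separated_primeD(2)[OF A] subringE(3,6)[OF ring] by (induction e) auto
  have "?q [^] l \<otimes> (c \<otimes> y [^] k) \<in> poly_vals A (?q \<otimes> y) k"
    using poly_vals_rescale[OF ring y q] c(3) l by simp
  also have "?q [^] l \<otimes> (c \<otimes> y [^] k) = ?u \<otimes> (?q [^] k \<otimes> y [^] k)"
  proof -
    have "?q [^] l \<otimes> ((?q \<otimes> ?u) \<otimes> y [^] k) = ?u \<otimes> (?q [^] k \<otimes> y [^] k)"
      unfolding l using car y by (simp add: m_ac)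
    then show ?thesis using cu by simp
  qed
  also have "?q [^] k \<otimes> y [^] k = (?q \<otimes> y) [^] k"
    using nat_pow_distrib[of ?q y k] y by simp
  finally show thesis using that u ur by blast
qed

section \<open>A Nakayama argument for adjoining algebraic elements\<close>

text \<open>The multiplicatively closed set \<open>(A - p A) + p S\<close>, over which the module generated by
  \<open>1, y, \<dots>, y^(n-1)\<close> is eliminated one generator at a time, as in Nakayama's lemma.\<close>

definition near_units :: "'a set \<Rightarrow> 'a set \<Rightarrow> 'a set" where
  "near_units A S = {t \<in> S. \<exists>v \<in> A. v \<otimes> r \<notin> A \<and> (t \<ominus> v) \<otimes> r \<in> S}"

context
  fixes A S
  assumes A: "separated_prime A" and S: "subring S R" and AS: "pure A S"
begin

lemmas S_carrier = subringE(1)[OF S, THEN subsetD]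
lemmas S_closed = subringE(5-7)[OF S]

lemma A_S: "a \<in> A \<Longrightarrow> a \<in> S"
  using AS by (auto simp: pure_def)

lemma near_unitsI:
  assumes "u \<in> A" "u \<otimes> r \<notin> A"
  shows "u \<in> near_units A S"
proof -
  have "u \<in> carrier R" using assms A_S S_carrier by blast
  then have "(u \<ominus> u) \<otimes> r = \<zero>" by (simp add: minus_eq r_neg)
  then show ?thesis using assms A_S subringE(2)[OF S] by (auto simp: near_units_def)
qed

text \<open>Modulo \<open>p S\<close> these elements come from elements of \<open>A\<close> outside
  \<open>p A\<close>, and such elements are closed under products because \<open>p\<close> is prime
  in \<open>A\<close>.\<close>

lemma near_units_mult:
  assumes "t \<in> near_units A S" "t' \<in> near_units A S"
  shows "t \<otimes> t' \<in> near_units A S"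
proof -
  from assms obtain v v' where *: "t \<in> S" "v \<in> A" "v \<otimes> r \<notin> A" "(t \<ominus> v) \<otimes> r \<in> S"
    "t' \<in> S" "v' \<in> A" "v' \<otimes> r \<notin> A" "(t' \<ominus> v') \<otimes> r \<in> S" by (auto simp: near_units_def)
  have car: "t \<in> carrier R" "v \<in> carrier R" "t' \<in> carrier R" "v' \<in> carrier R"
    using * A_S S_carrier by auto
  have "(t \<otimes> t' \<ominus> v \<otimes> v') \<otimes> r = (t \<ominus> v) \<otimes> r \<otimes> t' \<oplus> v \<otimes> ((t' \<ominus> v') \<otimes> r)"
    using car r_closed by algebra
  also have "\<dots> \<in> S" using * A_S S_closed by simp
  finally have "(t \<otimes> t' \<ominus> v \<otimes> v') \<otimes> r \<in> S" .
  moreover have "v \<otimes> v' \<otimes> r \<notin> A" using separated_primeD(4)[OF A] * by blast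
  moreover have "v \<otimes> v' \<in> A" using subringE(6)[OF separated_primeD(1)[OF A]] * by blast
  ultimately show ?thesis using * S_closed by (auto simp: near_units_def)
qed

lemma near_units_pow:
  "\<lbrakk>t \<in> near_units A S; t' \<in> near_units A S\<rbrakk> \<Longrightarrow> t [^] (k::nat) \<otimes> t' \<in> near_units A S"
proof (induction k)
  case 0
  then show ?case using S_carrier by (auto simp: near_units_def)
next
  case (Suc k)
  have "t \<in> carrier R" "t' \<in> carrier R" using Suc.prems S_carrier by (auto simp: near_units_def)
  then have "t [^] Suc k \<otimes> t' = t \<otimes> (t [^] k \<otimes> t')" by (simp add: m_ac)
  then show ?case using Suc near_units_mult by simp
qed

lemma near_units_minus:
  assumes "t \<in> near_units A S" "s \<in> S"
  shows "t \<ominus> p \<otimes> s \<in> near_units A S"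
proof -
  from assms obtain v where *: "t \<in> S" "v \<in> A" "v \<otimes> r \<notin> A" "(t \<ominus> v) \<otimes> r \<in> S"
    by (auto simp: near_units_def)
  have car: "t \<in> carrier R" "v \<in> carrier R" "s \<in> carrier R"
    using * assms A_S S_carrier by auto
  have "((t \<ominus> p \<otimes> s) \<ominus> v) \<otimes> r = (t \<ominus> v) \<otimes> r \<oplus> \<ominus> (p \<otimes> (s \<otimes> r))"
    using car r_closed p_closed by algebra
  also have "\<dots> = (t \<ominus> v) \<otimes> r \<oplus> \<ominus> s" using car by simp
  also have "\<dots> \<in> S" using * assms S_closed by simp
  finally have "((t \<ominus> p \<otimes> s) \<ominus> v) \<otimes> r \<in> S" .
  moreover have "t \<ominus> p \<otimes> s \<in> S"
    using * assms S_closed A_S separated_primeD(2)[OF A] by (simp add: minus_eq)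
  ultimately show ?thesis using * by (auto simp: near_units_def)
qed

text \<open>Otherwise some \<open>v\<close> outside \<open>p A\<close> would lie in
  \<open>p S\<close>, against purity. This is the contradiction that the elimination aims
  at.\<close>

lemma zero_not_near_unit: "\<zero> \<notin> near_units A S"
proof
  assume "\<zero> \<in> near_units A S"
  then obtain v where *: "v \<in> A" "v \<otimes> r \<notin> A" "(\<zero> \<ominus> v) \<otimes> r \<in> S" by (auto simp: near_units_def)
  have "v \<in> carrier R" using * A_S S_carrier by auto
  then have "\<ominus> ((\<zero> \<ominus> v) \<otimes> r) = v \<otimes> r" using r_closed by algebra
  then have "v \<otimes> r \<in> S" using S_closed(1)[OF *(3)] by simp
  then show False using * AS by (auto simp: pure_def)
qed

context
  fixes y u n
  assumes y: "y \<in> carrier R" and u: "u \<in> A" "u \<otimes> r \<notin> A"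
    and uy: "u \<otimes> y [^] (n::nat) \<in> poly_vals A y n"
begin

text \<open>By the relation, \<open>u\<close> times the top power \<open>y^(n+k)\<close> is a
  combination of lower powers, so each factor \<open>u\<close> lowers the degree bound by
  one.\<close>

lemma reduce_degree:
  "m \<in> poly_vals S y (n + k) \<Longrightarrow> u [^] k \<otimes> m \<in> poly_vals S y n"
proof (induction k arbitrary: m)
  case 0
  then show ?case using poly_vals_carrier[OF S y] by simp
next
  case (Suc k)
  then obtain m' s where *: "m = m' \<oplus> s \<otimes> y [^] (n + k)" "m' \<in> poly_vals S y (n + k)" "s \<in> S"
    by auto
  have car: "m' \<in> carrier R" "s \<in> carrier R" "u \<in> carrier R" "y [^] k \<in> carrier R" "y [^] n \<in> carrier R"
    using * u y A_S S_carrier poly_vals_carrier[OF S y] by auto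
  have "u \<otimes> y [^] n \<in> poly_vals S y n"
    using uy poly_vals_mono_coeffs[of A S] A_S by blast
  then have yk: "y [^] k \<otimes> (u \<otimes> y [^] n) \<in> poly_vals S y (n + k)"
    using poly_vals_shifts[OF S y] by (metis add.commute)
  have "u \<otimes> m = u \<otimes> m' \<oplus> s \<otimes> (y [^] k \<otimes> (u \<otimes> y [^] n))"
    unfolding * nat_pow_mult[OF y, symmetric] using car by algebra
  also have "\<dots> \<in> poly_vals S y (n + k)"
    by (rule poly_vals_add[OF S y poly_vals_smult[OF S y *(2) A_S[OF u(1)]]
          poly_vals_smult[OF S y yk *(3)]])
  finally have "u [^] k \<otimes> (u \<otimes> m) \<in> poly_vals S y n" by (rule Suc.IH)
  moreover have "m \<in> carrier R" using Suc.prems poly_vals_carrier[OF S y] by blast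
  ultimately show ?case using car by (simp add: m_assoc)
qed

text \<open>The relation for \<open>y^k\<close> expresses a near unit multiple of
  \<open>r y^k\<close> through lower powers. Multiplying the other relations by that near unit
  removes \<open>y^k\<close> from them too.\<close>

lemma eliminate_generator:
  assumes "k < n" and t: "t \<in> near_units A S"
    and red: "\<And>i. i < n \<Longrightarrow> t \<otimes> r \<otimes> y [^] i \<in> poly_vals S y (Suc k)"
  shows "\<exists>t' \<in> near_units A S. \<forall>i < n. t' \<otimes> r \<otimes> y [^] i \<in> poly_vals S y k"
proof -
  from red[OF \<open>k < n\<close>] obtain m s where
    *: "t \<otimes> r \<otimes> y [^] k = m \<oplus> s \<otimes> y [^] k" "m \<in> poly_vals S y k" "s \<in> S" by auto
  \<comment> \<open>Moving \<open>s y^k\<close> to the left side gives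
    \<open>(t - p s) r y^k = m\<close>, since \<open>p r = 1\<close>.\<close>
  define t' where "t' = t \<ominus> p \<otimes> s"
  have t': "t' \<in> near_units A S" unfolding t'_def by (rule near_units_minus[OF t *(3)])
  then have t'S: "t' \<in> S" by (simp add: near_units_def)
  have car: "m \<in> carrier R" "s \<in> carrier R" "t \<in> carrier R" "t' \<in> carrier R" "y [^] k \<in> carrier R"
    using * t t' S_carrier y poly_vals_carrier[OF S y] by (auto simp: near_units_def)
  have "t' \<otimes> r \<otimes> y [^] k = t \<otimes> r \<otimes> y [^] k \<ominus> (p \<otimes> (s \<otimes> r)) \<otimes> y [^] k"
    unfolding t'_def using car r_closed p_closed by algebra
  also have "\<dots> = m \<oplus> s \<otimes> y [^] k \<ominus> s \<otimes> y [^] k" using * car by simp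
  also have "\<dots> = m" using car by algebra
  finally have m: "t' \<otimes> r \<otimes> y [^] k = m" .
  have "t' \<otimes> t \<otimes> r \<otimes> y [^] i \<in> poly_vals S y k" if i: "i < n" for i
  proof -
    from red[OF i] obtain mi si where
      i: "t \<otimes> r \<otimes> y [^] i = mi \<oplus> si \<otimes> y [^] k" "mi \<in> poly_vals S y k" "si \<in> S" by auto
    have cari: "mi \<in> carrier R" "si \<in> carrier R" "y [^] i \<in> carrier R"
      using i S_carrier y poly_vals_carrier[OF S y] by auto
    have "t' \<otimes> t \<otimes> r \<otimes> y [^] i = t' \<otimes> (t \<otimes> r \<otimes> y [^] i)"
      using car cari by (simp add: m_assoc)
    also have "\<dots> = t' \<otimes> mi \<oplus> si \<otimes> (t' \<otimes> y [^] k)"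
      unfolding i(1) using car cari by algebra
    \<comment> \<open>Inserting \<open>p r = 1\<close> replaces \<open>t' y^k\<close> by
      \<open>p m\<close>, which involves only powers below \<open>k\<close>.\<close>
    also have "t' \<otimes> y [^] k = p \<otimes> (t' \<otimes> y [^] k \<otimes> r)"
      using car by simp
    also have "t' \<otimes> y [^] k \<otimes> r = m"
      using m car by (simp add: m_ac)
    also have "t' \<otimes> mi \<oplus> si \<otimes> (p \<otimes> m) \<in> poly_vals S y k"
      using poly_vals_add[OF S y] poly_vals_smult[OF S y] i *(2) t'S A_S separated_primeD(2)[OF A]
      by simp
    finally show ?thesis .
  qed
  then show ?thesis using near_units_mult[OF t' t] by blast
qed

text \<open>Suppose \<open>w r\<close> lies in \<open>S[y]\<close> with \<open>w\<close> in
  \<open>A\<close> outside \<open>p A\<close>. A near unit \<open>t\<close> then satisfies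
  \<open>t M \<subseteq> p M\<close> for the module \<open>M\<close> spanned by
  \<open>1, ..., y^(n-1)\<close>. Eliminating all generators yields a near unit that kills
  \<open>M\<close>, hence kills \<open>1\<close>.\<close>

lemma pure_adjoin_integral: "pure A (adjoin S y)"
  unfolding pure_def
proof (intro conjI ballI impI)
  show "A \<subseteq> adjoin S y" using A_S subset_adjoin[OF S y] by blast
next
  fix w assume w: "w \<in> A" "w \<otimes> r \<in> adjoin S y"
  show "w \<otimes> r \<in> A"
  proof (rule ccontr)
    assume wr: "w \<otimes> r \<notin> A"
    obtain d where d: "w \<otimes> r \<in> poly_vals S y d" using w by (auto simp: adjoin_def)
    \<comment> \<open>For \<open>i < n\<close> the product \<open>y^i w r\<close> has degree bound
      at most \<open>n + (n + d)\<close>, so \<open>n + d\<close> factors \<open>u\<close> bring it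
      down to \<open>n\<close>.\<close>
    define t where "t = u [^] (n + d) \<otimes> w"
    have car: "u \<in> carrier R" "w \<in> carrier R" using u w A_S S_carrier by auto
    have t: "t \<in> near_units A S"
      unfolding t_def using near_units_pow near_unitsI u w wr by blast
    have start: "t \<otimes> r \<otimes> y [^] i \<in> poly_vals S y n" if "i < n" for i
    proof -
      have "y [^] i \<otimes> (w \<otimes> r) \<in> poly_vals S y (n + (n + d))"
        using poly_vals_mono[OF S y poly_vals_shifts[OF S y d]] that by simp
      from reduce_degree[OF this] show ?thesis
        unfolding t_def using car y by (simp add: m_ac)
    qed
    have "\<exists>t \<in> near_units A S. \<forall>i < n. t \<otimes> r \<otimes> y [^] i \<in> poly_vals S y k" if "k \<le> n" for k
      using that
    proof (induction k rule: inc_induct)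
      case base
      then show ?case using t start by blast
    next
      case (step k)
      then show ?case using eliminate_generator[of k] by blast
    qed
    from this[of 0] obtain t0 where
      t0: "t0 \<in> near_units A S" "\<And>i. i < n \<Longrightarrow> t0 \<otimes> r \<otimes> y [^] i = \<zero>" by auto
    have t0c: "t0 \<in> carrier R" using t0 S_carrier by (auto simp: near_units_def)
    show False
    \<comment> \<open>For \<open>n = 0\<close> there is no generator \<open>1\<close> to use, but
      the relation itself then reads \<open>u = 0\<close>.\<close>
    proof (cases "n = 0")
      case True
      then have "u = \<zero>" using uy car by simp
      then show False using u subringE(2)[OF separated_primeD(1)[OF A]] by simp
    next
      case False
      then have "t0 \<otimes> r = \<zero>" using t0(2)[of 0] t0c by simp
      then have "t0 = \<zero>" using mult_r_eq_iff[of t0 \<zero>] t0c by simp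
      then show False using t0 zero_not_near_unit by simp
    qed
  qed
qed

end

end

section \<open>Construction of the maximal subring\<close>

text \<open>Take \<open>M\<close> maximal among the subrings that contain \<open>S\<close> and avoid
  \<open>r\<close>. A strictly larger subring contains \<open>r\<close> and its powers, hence every
  \<open>y = (p^e y) r^e\<close>.\<close>

lemma submaximal_if_generated:
  assumes S: "subring S R" "r \<notin> S" and gen: "\<And>y. y \<in> carrier R \<Longrightarrow> \<exists>e::nat. p [^] e \<otimes> y \<in> S"
  shows "submaximal R"
proof -
  from S obtain M where M: "subring M R" "S \<subseteq> M" "M \<inter> {r} = {}"
    "\<And>T. \<lbrakk>subring T R; M \<subseteq> T; T \<inter> {r} = {}\<rbrakk> \<Longrightarrow> T = M"
    using maximal_avoiding_subring[of S "{r}"] by auto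
  have "T = carrier R" if T: "subring T R" "M \<subset> T" for T
  proof
    show "T \<subseteq> carrier R" using subringE(1)[OF T(1)] .
    have "r \<in> T" using M(4)[OF T(1)] T(2) by blast
    then have rn: "r [^] (e::nat) \<in> T" for e using subringE(3,6)[OF T(1)] by (induction e) auto
    show "carrier R \<subseteq> T"
    proof
      fix y assume y: "y \<in> carrier R"
      then obtain e :: nat where "p [^] e \<otimes> y \<in> S" using gen by blast
      then have "(p [^] e \<otimes> y) \<otimes> r [^] e \<in> T" using rn M(2) T subringE(6)[OF T(1)] by blast
      moreover have "(p [^] e \<otimes> y) \<otimes> r [^] e = y"
        using mult_r_pow_eq_iff[of "p [^] e \<otimes> y" y e] y by simp
      ultimately show "y \<in> T" by simp
    qed
  qed
  moreover have "M \<subset> carrier R" using M subringE(1)[OF M(1)] r_closed by blast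
  ultimately show ?thesis
    using M(1) unfolding submaximal_def maximal_subring_def by blast
qed

lemma submaximal_if_separated_prime:
  assumes "separated_prime D"
  shows "submaximal R"
proof -
  obtain A where A: "separated_prime A" "\<And>B. \<lbrakk>separated_prime B; pure A B\<rbrakk> \<Longrightarrow> B = A"
    using maximal_separated_prime[OF assms] by blast
  note ring = separated_primeD(1)[OF A(1)]
  \<comment> \<open>These are the quotients by \<open>p\<close> that purity forbids, so maximal pure
    extensions of \<open>A\<close> are maximal subrings avoiding \<open>W\<close>.\<close>
  define W where "W = {x \<otimes> r | x. x \<in> A \<and> x \<otimes> r \<notin> A}"
  have pure_iff: "pure A T \<longleftrightarrow> A \<subseteq> T \<and> T \<inter> W = {}" for T
    unfolding pure_def W_def by blast
  obtain S where S: "subring S R" "A \<subseteq> S" "S \<inter> W = {}"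
    "\<And>T. \<lbrakk>subring T R; S \<subseteq> T; T \<inter> W = {}\<rbrakk> \<Longrightarrow> T = S"
    using maximal_avoiding_subring[of A W] ring pure_refl[of A] pure_iff by blast
  have pure: "pure A S" using S pure_iff by blast
  show ?thesis
  proof (rule submaximal_if_generated[OF S(1)])
    show "r \<notin> S"
      using pure subringE(3)[OF ring] separated_primeD(3)[OF A(1)]
      by (metis l_one pure_def r_closed)
  next
    fix y assume y: "y \<in> carrier R"
    obtain k c where "c \<in> A" "c \<noteq> \<zero>" "c \<otimes> y [^] (k::nat) \<in> poly_vals A y k"
      using maximal_imp_algebraic[OF A y] by blast
    then obtain e u where u: "u \<in> A" "u \<otimes> r \<notin> A"
      "u \<otimes> (p [^] (e::nat) \<otimes> y) [^] k \<in> poly_vals A (p [^] e \<otimes> y) k"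
      using algebraic_rescale[OF A(1) y] by metis
    let ?z = "p [^] e \<otimes> y"
    have z: "?z \<in> carrier R" using y by simp
    \<comment> \<open>Adjoining \<open>p^e y\<close> to \<open>S\<close> preserves purity, so
      maximality of \<open>S\<close> already places it in \<open>S\<close>.\<close>
    have "pure A (adjoin S ?z)" by (rule pure_adjoin_integral[OF A(1) S(1) pure z u])
    then have "adjoin S ?z = S"
      using S(4) subring_adjoin[OF S(1) z] subset_adjoin[OF S(1) z] pure_iff by blast
    then have "?z \<in> S" using mem_adjoin[OF S(1) z] by simp
    then show "\<exists>e::nat. p [^] e \<otimes> y \<in> S" by blast
  qed
qed

end

section \<open>Factorial domains and the final reduction\<close>

text \<open>Irreducibles in a factorial domain are prime, and well-foundedness of proper
  divisibility bounds the power of \<open>p\<close> in a nonzero element.\<close>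

lemma (in cring) separated_prime_if_irreducible:
  assumes D: "subring D R" "factorial_domain (R \<lparr> carrier := D \<rparr>)"
    and p: "p \<in> D" "ring_irreducible\<^bsub>R \<lparr> carrier := D \<rparr>\<^esub> p" "p \<in> Units R"
  shows "cring_inverse.separated_prime R p (inv p) D"
proof -
  let ?D = "R \<lparr> carrier := D \<rparr>"
  interpret E: factorial_domain ?D by (rule D(2))
  interpret cring_inverse R p "inv p"
    using p(3) by unfold_locales auto
  have car: "x \<in> carrier R" if "x \<in> D" for x using that subringE(1)[OF D(1)] by blast
  have dvd: "p divides\<^bsub>?D\<^esub> x \<longleftrightarrow> x \<otimes> inv p \<in> D" if "x \<in> D" for x
  proof
    assume "p divides\<^bsub>?D\<^esub> x"
    then obtain c where c: "c \<in> D" "x = p \<otimes> c" by (auto simp: factor_def)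
    then have "x \<otimes> inv p = c" using mult_r_eq_iff[OF car[OF that] car[OF c(1)]] by blast
    then show "x \<otimes> inv p \<in> D" using c(1) by blast
  next
    assume "x \<otimes> inv p \<in> D"
    moreover have "x = p \<otimes> (x \<otimes> inv p)" using p_mult_mult_r[OF car[OF that]] by (rule sym)
    ultimately show "p divides\<^bsub>?D\<^esub> x" by (auto intro: dividesI)
  qed
  have p0: "p \<noteq> \<zero>" and irr: "irreducible (mult_of ?D) p" and nu: "p \<notin> Units ?D"
    using E.ring_irreducibleE[of p] p by auto
  have "prime (mult_of ?D) p"
    using E.irreducible_prime[of p] irr p p0 by simp
  then have prime: "prime ?D p" using E.prime_eq_prime_mult p by simp
  show ?thesis
    unfolding separated_prime_def
  proof (intro conjI ballI impI D(1) p(1))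
    show "inv p \<notin> D"
      using nu p(1) p_r r_p by (auto simp: Units_def)
  next
    fix x y assume xy: "x \<in> D" "y \<in> D" "x \<otimes> y \<otimes> inv p \<in> D"
    then have "p divides\<^bsub>?D\<^esub> (x \<otimes> y)" using dvd subringE(6)[OF D(1)] by simp
    then show "x \<otimes> inv p \<in> D \<or> y \<otimes> inv p \<in> D"
      using prime xy dvd unfolding prime_def by auto
  next
    fix x assume "x \<in> D" "x \<noteq> \<zero>"
    then show "\<exists>n::nat. x \<otimes> inv p [^] n \<notin> D"
    proof (induction x rule: wf_induct_rule[OF E.division_wellfounded])
      case (1 x)
      note x = "1.prems"
      show ?case
      proof (cases "x \<otimes> inv p \<in> D")
        case False
        then show ?thesis using car[OF x(1)] by (intro exI[of _ 1]) simp
      next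
        case True
        let ?z = "x \<otimes> inv p"
        have xz: "x = p \<otimes> ?z" using p_mult_mult_r[OF car[OF x(1)]] by (rule sym)
        then have z0: "?z \<noteq> \<zero>" using x(2) r_null[OF p_closed] by metis
        have zp: "x = ?z \<otimes> p" using xz m_comm[OF p_closed car[OF True]] by simp
        \<comment> \<open>As \<open>p\<close> is not a unit of \<open>D\<close>, dividing by it
          gives a proper divisor, to which the induction hypothesis applies.\<close>
        have "properfactor (mult_of ?D) ?z x"
          by (rule E.mult_of.properfactorI3[of x ?z p]) (use zp z0 True p(1) p0 nu in simp_all)
        then obtain n :: nat where "?z \<otimes> inv p [^] n \<notin> D"
          using "1.IH"[of ?z] True z0 x by auto
        moreover have "?z \<otimes> inv p [^] n = x \<otimes> inv p [^] Suc n"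
          using car[OF x(1)] by (simp add: m_ac)
        ultimately show ?thesis by metis
      qed
    qed
  qed
qed

lemma (in cring) submaximal_if_irreducible_unit:
  assumes "subring D R" "factorial_domain (R \<lparr> carrier := D \<rparr>)"
    and "p \<in> D" "ring_irreducible\<^bsub>R \<lparr> carrier := D \<rparr>\<^esub> p" "p \<in> Units R"
  shows "submaximal R"
proof -
  interpret cring_inverse R p "inv p"
    using assms(5) by unfold_locales auto
  show ?thesis
    using submaximal_if_separated_prime[OF separated_prime_if_irreducible[OF assms]] .
qed

text \<open>Factor \<open>d\<close> into irreducibles of \<open>D\<close>. Any factor of a unit of
  \<open>R\<close> is a unit of \<open>R\<close>, so the first irreducible factor will do.\<close>

lemma (in cring) exists_irreducible_unit:
  assumes "\<one> \<noteq> \<zero>" and D: "subring D R" "factorial_domain (R \<lparr> carrier := D \<rparr>)"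
    and d: "d \<in> D" "d \<in> Units R" "d \<notin> Units (R \<lparr> carrier := D \<rparr>)"
  shows "\<exists>p \<in> D. ring_irreducible\<^bsub>R \<lparr> carrier := D \<rparr>\<^esub> p \<and> p \<in> Units R"
proof -
  let ?D = "R \<lparr> carrier := D \<rparr>"
  interpret E: factorial_domain ?D by (rule D(2))
  have car: "x \<in> carrier R" if "x \<in> D" for x using that subringE(1)[OF D(1)] by blast
  have d0: "d \<noteq> \<zero>"
    using assms(1) Units_r_inv[OF d(2)] Units_inv_closed[OF d(2)] by auto
  obtain fs where fs: "set fs \<subseteq> carrier (mult_of ?D)" "factors (mult_of ?D) fs d"
    using E.factors_exist[of d] d d0 by auto
  \<comment> \<open>An empty factorization would make \<open>d\<close> a unit of
    \<open>D\<close>.\<close>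
  then have "fs \<noteq> []"
    using E.mult_of.nunit_factors[of d fs] d(3) by auto
  then obtain p gs where ps: "fs = p # gs" by (meson list.exhaust)
  then have p: "p \<in> D" "p \<noteq> \<zero>" "irreducible (mult_of ?D) p"
    using fs by (auto simp: factors_def)
  obtain c where c: "c \<in> D" "d = p \<otimes> c"
    using fs ps E.mult_of.multlist_closed[of gs] by (auto simp: factors_def)
  have "p \<in> Units R"
    using d(2) c car p unit_factor by metis
  moreover have "ring_irreducible\<^bsub>?D\<^esub> p"
    using E.ring_irreducibleI'[of p] p by simp
  ultimately show ?thesis using p by blast
qed

theorem theorem1p2:
  fixes R :: "('a, 'b) ring_scheme" (structure) and D :: "'a set"
  assumes "cring R" and "\<one> \<noteq> \<zero>"
    and "subring D R" and "factorial_domain (R \<lparr> carrier := D \<rparr>)"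
  shows "((\<exists>p \<in> D. ring_irreducible\<^bsub>R \<lparr> carrier := D \<rparr>\<^esub> p \<and> p \<in> Units R) \<longrightarrow> submaximal R) \<and>
         (Units R \<inter> D \<noteq> Units (R \<lparr> carrier := D \<rparr>) \<longrightarrow> submaximal R)"
proof -
  interpret cring R by (rule assms(1))
  let ?D = "R \<lparr> carrier := D \<rparr>"
  have irr: "submaximal R" if "\<exists>p \<in> D. ring_irreducible\<^bsub>?D\<^esub> p \<and> p \<in> Units R"
    using that submaximal_if_irreducible_unit[OF assms(3,4)] by blast
  moreover have "submaximal R" if "Units R \<inter> D \<noteq> Units ?D"
  proof -
    \<comment> \<open>This inclusion always holds, so inequality of the two sets provides a unit of
      \<open>R\<close> in \<open>D\<close> that is not a unit of \<open>D\<close>.\<close>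
    have "Units ?D \<subseteq> Units R \<inter> D"
      using subringE(1)[OF assms(3)] by (auto simp: Units_def)
    with that obtain d where "d \<in> D" "d \<in> Units R" "d \<notin> Units ?D" by blast
    then show ?thesis using irr exists_irreducible_unit[OF assms(2-4)] by blast
  qed
  ultimately show ?thesis by blast
qed

end
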